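(* Let $\nu>0$ and let $m,m'\ge0$ be integers. For every $t\in\mathbb{C}$ with $|t|=1$ and all $z,w\in\mathbb{C}$, $$\sum_{n=0}^{+\infty}\frac{t^n}{n!\,\nu^n}\,H_{m,n}^{\nu}(z,\overline{z})\,H_{n,m'}^{\nu}(w,\overline{w})=(-t)^{m'}\,H_{m,m'}^{\nu}\left(z-tw,\overline{z}-\overline{t}\,\overline{w}\right)e^{\nu t w\overline{z}}.$$
   Context: The univariate complex Hermite polynomials are, for integers $m,n\ge0$, $$H_{m,n}^\nu(z,\overline{z})=(-1)^{m+n}e^{\nu z\overline{z}}\frac{\partial^{m+n}}{\partial \overline{z}^{m}\partial z^{n}}\left(e^{-\nu z\overline{z}}\right),$$ where $\partial/\partial z$ and $\partial/\partial\overline{z}$ are the Wirtinger derivatives. *)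

theory Defs
  imports "HOL-Analysis.Analysis"
begin

text \<open>The real Frechet derivative applied to \<open>1\<close> and \<open>\<i>\<close> gives the partial derivatives
  with respect to \<open>x\<close> and \<open>y\<close>, where \<open>z = x + \<i>y\<close>.\<close>

definition wirtinger :: "(complex \<Rightarrow> complex) \<Rightarrow> complex \<Rightarrow> complex" where
  "wirtinger f z =
     (frechet_derivative f (at z) 1 - \<i> * frechet_derivative f (at z) \<i>) / 2"

definition wirtinger_bar :: "(complex \<Rightarrow> complex) \<Rightarrow> complex \<Rightarrow> complex" where
  "wirtinger_bar f z =
     (frechet_derivative f (at z) 1 + \<i> * frechet_derivative f (at z) \<i>) / 2"

text \<open>\<open>complex_hermite \<nu> m n z\<close> is the value usually written with the pair of arguments
  \<open>z\<close>, \<open>cnj z\<close>; as the second is always the conjugate of the first, it is left out.\<close>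

definition complex_hermite :: "real \<Rightarrow> nat \<Rightarrow> nat \<Rightarrow> complex \<Rightarrow> complex" where
  "complex_hermite \<nu> m n z =
     (- 1) ^ (m + n) * exp (of_real \<nu> * z * cnj z) *
     (wirtinger_bar ^^ m) ((wirtinger ^^ n) (\<lambda>u. exp (- (of_real \<nu> * u * cnj u)))) z"

end

theory Submission imports Defs begin

text \<open>
  The complex Hermite functions are polynomials in \<open>z\<close> and \<open>cnj z\<close> on which the creation
  operators \<open>\<nu> z - \<partial>/\<partial>(cnj z)\<close> and \<open>\<nu> (cnj z) - \<partial>/\<partial>z\<close> raise the first and the second index,
  while \<open>\<partial>/\<partial>(cnj z)\<close> and \<open>\<partial>/\<partial>z\<close> lower them up to a factor. Eliminating the derivatives leaves
  two purely algebraic recurrences,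
  \<open>H (m+1) n = \<nu> z H m n - n \<nu> H m (n-1)\<close> and
  \<open>H m (n+1) = \<nu> (cnj z) H m n - m \<nu> H (m-1) n\<close>.

  These already force the summation formula. Write \<open>S m m'\<close> for the sum. Applying the first
  recurrence to the factor in \<open>z\<close> produces a term with coefficient \<open>n\<close>, which cancels against
  \<open>n!\<close>, so that an index shift turns it into a sum containing \<open>H (n+1) m' w\<close>; the
  first recurrence, now at \<open>w\<close>, gives
  \<open>S (m+1) m' = \<nu> (z - t w) S m m' + t m' \<nu> S m (m'-1)\<close>.
  This is the first recurrence at the point \<open>z - t w\<close>, once the factor \<open>(-t)^m'\<close> is
  taken into account. In the same way the second recurrence gives
  \<open>S 0 (m'+1) = \<nu> (cnj w - t cnj z) S 0 m'\<close>, and since \<open>t cnj t = 1\<close> the factor on the right is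
  \<open>- t \<nu> cnj (z - t w)\<close>. The induction starts at \<open>S 0 0\<close>, the exponential series. Convergence is
  carried along by the induction, so no estimate is needed.
\<close>

section \<open>The polynomials and their recurrences\<close>

text \<open>Taking the recurrence in the first index as the definition makes the derivative formulas
  provable by induction.\<close>

fun hermite_poly :: "real \<Rightarrow> nat \<Rightarrow> nat \<Rightarrow> complex \<Rightarrow> complex" where
  "hermite_poly \<nu> 0 n z = (of_real \<nu> * cnj z) ^ n"
| "hermite_poly \<nu> (Suc m) n z =
     of_real \<nu> * z * hermite_poly \<nu> m n z
     - of_nat n * of_real \<nu> * hermite_poly \<nu> m (n - 1) z"

text \<open>The recursion in the other index. The value \<open>m - 1\<close> at \<open>m = 0\<close> is harmless, as
  it is multiplied by \<open>of_nat m\<close>.\<close>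

lemma hermite_poly_Suc_right:
  "hermite_poly \<nu> m (Suc n) z =
     of_real \<nu> * cnj z * hermite_poly \<nu> m n z
     - of_nat m * of_real \<nu> * hermite_poly \<nu> (m - 1) n z"
proof (induction m arbitrary: n)
  case 0
  show ?case by simp
next
  case (Suc m)
  let ?P = "\<lambda>i j. hermite_poly \<nu> i j z"
  let ?v = "of_real \<nu> :: complex"
  \<comment> \<open>Both sides of the goal are expanded to index \<open>m\<close>; what is left over is matched by these
    two expressions for the multiples of \<open>?P m n\<close>.\<close>
  have left: "of_nat m * ?P m n =
      of_nat m * (?v * z * ?P (m - 1) n - of_nat n * ?v * ?P (m - 1) (n - 1))"
    by (cases m) auto
  have right: "of_nat n * ?P m n =
      of_nat n * (?v * cnj z * ?P m (n - 1) - of_nat m * ?v * ?P (m - 1) (n - 1))"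
    using Suc.IH[of "n - 1"] by (cases n) auto
  have "?P (Suc m) (Suc n) - (?v * cnj z * ?P (Suc m) n - of_nat (Suc m) * ?v * ?P m n) =
      ?v * (of_nat m * ?P m n
        - of_nat m * (?v * z * ?P (m - 1) n - of_nat n * ?v * ?P (m - 1) (n - 1)))
      - ?v * (of_nat n * ?P m n
        - of_nat n * (?v * cnj z * ?P m (n - 1) - of_nat m * ?v * ?P (m - 1) (n - 1)))"
    by (simp add: Suc.IH algebra_simps)
  also have "\<dots> = 0"
    by (simp only: left[symmetric] right[symmetric]) simp
  finally show ?case by simp
qed

section \<open>Wirtinger derivatives\<close>

text \<open>Real linear maps on \<open>\<complex>\<close> are the combinations of \<open>h\<close> and \<open>cnj h\<close>, and the two Wirtinger
  derivatives are the coefficients of the Frechet derivative in this basis.\<close>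

lemma wirtinger_eqI:
  assumes "(f has_derivative (\<lambda>h. a * h + b * cnj h)) (at z)"
  shows "wirtinger f z = a" and "wirtinger_bar f z = b"
proof -
  have "frechet_derivative f (at z) = (\<lambda>h. a * h + b * cnj h)"
    using frechet_derivative_at[OF assms] by simp
  then show "wirtinger f z = a" "wirtinger_bar f z = b"
    by (simp_all add: wirtinger_def wirtinger_bar_def algebra_simps)
qed

text \<open>The derivatives lower the indices; this is the only analytic fact about the polynomials
  that is needed.\<close>

lemma has_derivative_hermite_poly:
  "(hermite_poly \<nu> m n has_derivative
     (\<lambda>h. of_nat m * of_real \<nu> * hermite_poly \<nu> (m - 1) n z * h
        + of_nat n * of_real \<nu> * hermite_poly \<nu> m (n - 1) z * cnj h)) (at z)"
proof (induction m arbitrary: n)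
  case 0
  have "((\<lambda>u. (of_real \<nu> * cnj u) ^ n) has_derivative
      (\<lambda>h. of_nat n * (of_real \<nu> * cnj h) * (of_real \<nu> * cnj z) ^ (n - 1))) (at z)"
    by (rule derivative_eq_intros has_derivative_cnj refl | simp)+
  then show ?case by (simp add: mult_ac)
next
  case (Suc m)
  let ?P = "\<lambda>i j. hermite_poly \<nu> i j z"
  let ?v = "of_real \<nu> :: complex"
  have eq: "hermite_poly \<nu> (Suc m) n = (\<lambda>u. of_real \<nu> * u * hermite_poly \<nu> m n u
     - of_nat n * of_real \<nu> * hermite_poly \<nu> m (n - 1) u)"
    by (rule ext) simp
  have coeff: "of_nat m * (?v * z * ?P (m - 1) n - of_nat n * ?v * ?P (m - 1) (n - 1))
      = of_nat m * ?P m n"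
    by (cases m) auto
  have "(hermite_poly \<nu> (Suc m) n has_derivative
      (\<lambda>h. (?v * z) * (of_nat m * ?v * ?P (m - 1) n * h + of_nat n * ?v * ?P m (n - 1) * cnj h)
         + ?v * h * ?P m n
         - of_nat n * ?v * (of_nat m * ?v * ?P (m - 1) (n - 1) * h
             + of_nat (n - 1) * ?v * ?P m (n - 1 - 1) * cnj h))) (at z)"
    unfolding eq
    by (intro has_derivative_diff has_derivative_mult has_derivative_mult_right
        has_derivative_ident Suc.IH)
  also have "(\<lambda>h. (?v * z) * (of_nat m * ?v * ?P (m - 1) n * h + of_nat n * ?v * ?P m (n - 1) * cnj h)
         + ?v * h * ?P m n
         - of_nat n * ?v * (of_nat m * ?v * ?P (m - 1) (n - 1) * h
             + of_nat (n - 1) * ?v * ?P m (n - 1 - 1) * cnj h)) =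
      (\<lambda>h. ?v * h * (of_nat m * (?v * z * ?P (m - 1) n - of_nat n * ?v * ?P (m - 1) (n - 1)))
         + ?v * h * ?P m n + of_nat n * ?v * ?P (Suc m) (n - 1) * cnj h)"
    by (rule ext) (simp add: algebra_simps)
  also have "\<dots> = (\<lambda>h. of_nat (Suc m) * ?v * ?P (Suc m - 1) n * h
      + of_nat n * ?v * ?P (Suc m) (n - 1) * cnj h)"
    by (simp only: coeff) (simp add: algebra_simps)
  finally show ?case .
qed

lemma has_derivative_gaussian:
  "((\<lambda>u. exp (- (of_real \<nu> * u * cnj u))) has_derivative
     (\<lambda>h. - (of_real \<nu> * cnj z * exp (- (of_real \<nu> * z * cnj z))) * h
        + - (of_real \<nu> * z * exp (- (of_real \<nu> * z * cnj z))) * cnj h)) (at z)"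
proof -
  have "((\<lambda>u. - (of_real \<nu> * u * cnj u)) has_derivative
     (\<lambda>h. - (of_real \<nu> * z * cnj h + of_real \<nu> * h * cnj z))) (at z)"
    by (rule derivative_eq_intros has_derivative_cnj refl | simp)+
  from has_derivative_compose[OF this DERIV_exp[unfolded has_field_derivative_def]] show ?thesis
    by (simp add: algebra_simps)
qed

text \<open>Conjugated by the Gaussian, the Wirtinger derivatives become the negatives of the creation
  operators, which is why they raise the indices. The constant \<open>c\<close> absorbs the signs that
  accumulate under iteration.\<close>

lemma wirtinger_hermite_poly_gaussian:
  fixes \<nu> :: real and c :: complex
  defines "F \<equiv> \<lambda>m n u. c * hermite_poly \<nu> m n u * exp (- (of_real \<nu> * u * cnj u))"
  shows "wirtinger (F m n) z = - F m (Suc n) z"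
    and "wirtinger_bar (F m n) z = - F (Suc m) n z"
proof -
  let ?P = "\<lambda>i j. hermite_poly \<nu> i j z"
  let ?v = "of_real \<nu> :: complex"
  let ?g = "exp (- (?v * z * cnj z))"
  have "(F m n has_derivative
      (\<lambda>h. c * ?P m n * (- (?v * cnj z * ?g) * h + - (?v * z * ?g) * cnj h)
        + c * (of_nat m * ?v * ?P (m - 1) n * h + of_nat n * ?v * ?P m (n - 1) * cnj h) * ?g)) (at z)"
    unfolding F_def
    by (intro has_derivative_mult has_derivative_mult_right has_derivative_gaussian
        has_derivative_hermite_poly)
  also have "(\<lambda>h. c * ?P m n * (- (?v * cnj z * ?g) * h + - (?v * z * ?g) * cnj h)
        + c * (of_nat m * ?v * ?P (m - 1) n * h + of_nat n * ?v * ?P m (n - 1) * cnj h) * ?g) =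
      (\<lambda>h. - F m (Suc n) z * h + - F (Suc m) n z * cnj h)"
    by (rule ext) (simp add: F_def hermite_poly_Suc_right algebra_simps)
  finally show "wirtinger (F m n) z = - F m (Suc n) z" "wirtinger_bar (F m n) z = - F (Suc m) n z"
    by (rule wirtinger_eqI)+
qed

lemma complex_hermite_eq_hermite_poly:
  "complex_hermite \<nu> m n z = hermite_poly \<nu> m n z"
proof -
  define g :: "complex \<Rightarrow> complex" where "g u = exp (- (of_real \<nu> * u * cnj u))" for u
  have right: "(wirtinger ^^ n) g = (\<lambda>u. (- 1) ^ n * hermite_poly \<nu> 0 n u * g u)"
  proof (induction n)
    case (Suc n)
    show ?case
      using wirtinger_hermite_poly_gaussian(1)[of "(- 1) ^ n" \<nu> 0 n]
      by (simp only: funpow.simps o_apply Suc.IH) (simp add: g_def fun_eq_iff)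
  qed (simp add: g_def)
  have "(wirtinger_bar ^^ m) ((wirtinger ^^ n) g)
      = (\<lambda>u. (- 1) ^ (m + n) * hermite_poly \<nu> m n u * g u)"
  proof (induction m)
    case 0
    show ?case by (simp add: right)
  next
    case (Suc m)
    show ?case
      using wirtinger_hermite_poly_gaussian(2)[of "(- 1) ^ (m + n)" \<nu> m n]
      by (simp only: funpow.simps o_apply Suc.IH) (simp add: g_def fun_eq_iff)
  qed
  moreover have "exp (of_real \<nu> * z * cnj z) * g z = 1"
    by (simp add: g_def flip: exp_add)
  ultimately show ?thesis
    by (simp add: complex_hermite_def g_def[abs_def] mult_ac flip: power_add mult_2)
qed

section \<open>The summation formula\<close>

text \<open>The column \<open>m = 0\<close>, where \<open>H 0 n z = \<nu>^n (cnj z)^n\<close> and the power of \<open>\<nu>\<close> cancels. The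
  second recurrence at \<open>w\<close> multiplies the sum by a constant, which is the one demanded by the
  power \<open>H 0 m' (z - t w)\<close> because \<open>t\<close> lies on the unit circle.\<close>

lemma hermite_poly_sums_base:
  fixes \<nu> :: real and t z w :: complex
  assumes "norm t = 1"
  shows "(\<lambda>n. t ^ n / fact n * cnj z ^ n * hermite_poly \<nu> n m' w)
         sums ((- t) ^ m' * hermite_poly \<nu> 0 m' (z - t * w) * exp (of_real \<nu> * t * w * cnj z))"
proof (induction m')
  case 0
  have "hermite_poly \<nu> n 0 w = (of_real \<nu> * w) ^ n" for n
    by (induction n) auto
  moreover have "(\<lambda>n. (of_real \<nu> * t * w * cnj z) ^ n /\<^sub>R fact n)
      sums exp (of_real \<nu> * t * w * cnj z)"
    by (rule exp_converges)
  ultimately show ?case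
    by (simp add: scaleR_conv_of_real field_simps power_mult_distrib)
next
  case (Suc m')
  let ?v = "of_real \<nu> :: complex"
  let ?T = "\<lambda>n. t ^ n / fact n * cnj z ^ n * hermite_poly \<nu> n m' w"
  let ?s = "(- t) ^ m' * hermite_poly \<nu> 0 m' (z - t * w) * exp (?v * t * w * cnj z)"
  let ?Q = "\<lambda>n. t ^ n / fact n * cnj z ^ n * (of_nat n * ?v * hermite_poly \<nu> (n - 1) m' w)"
  have "?Q (Suc n) = t * ?v * cnj z * ?T n" for n
    using of_nat_neq_0[of n, where ?'a = complex] by (simp add: field_simps del: of_nat_Suc)
  moreover have "(\<lambda>n. t * ?v * cnj z * ?T n) sums (t * ?v * cnj z * ?s)"
    by (rule sums_mult[OF Suc.IH])
  ultimately have "(\<lambda>n. ?Q (Suc n)) sums (t * ?v * cnj z * ?s)"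
    by simp
  then have "?Q sums (t * ?v * cnj z * ?s + ?Q 0)"
    by (rule sums_Suc)
  then have "(\<lambda>n. ?v * cnj w * ?T n - ?Q n) sums (?v * cnj w * ?s - t * ?v * cnj z * ?s)"
    by (intro sums_diff sums_mult Suc.IH) simp
  moreover have "?v * cnj w * ?s - t * ?v * cnj z * ?s =
      (- t) ^ Suc m' * hermite_poly \<nu> 0 (Suc m') (z - t * w) * exp (?v * t * w * cnj z)"
  proof -
    have "t * cnj t = 1"
      using assms by (simp add: complex_norm_square[symmetric])
    then have "?v * cnj w - t * ?v * cnj z = - t * (?v * cnj (z - t * w))"
      by (simp add: algebra_simps)
    then have "?v * cnj w * ?s - t * ?v * cnj z * ?s = - t * (?v * cnj (z - t * w)) * ?s"
      by (simp only: left_diff_distrib[symmetric])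
    then show ?thesis
      by (simp add: mult_ac)
  qed
  ultimately show ?case
    by (simp only: hermite_poly_Suc_right) (simp add: algebra_simps)
qed

text \<open>The induction on \<open>m\<close> has to run over all \<open>m'\<close> at once, since the recurrence at \<open>w\<close> lowers
  \<open>m'\<close>.\<close>

lemma hermite_poly_sums:
  fixes \<nu> :: real and t z w :: complex
  assumes "\<nu> \<noteq> 0" and "norm t = 1"
  shows "(\<lambda>n. t ^ n / (fact n * of_real \<nu> ^ n) * hermite_poly \<nu> m n z * hermite_poly \<nu> n m' w)
         sums ((- t) ^ m' * hermite_poly \<nu> m m' (z - t * w) * exp (of_real \<nu> * t * w * cnj z))"
proof (induction m arbitrary: m')
  case 0
  have "t ^ n / (fact n * of_real \<nu> ^ n) * hermite_poly \<nu> 0 n z * hermite_poly \<nu> n m' w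
      = t ^ n / fact n * cnj z ^ n * hermite_poly \<nu> n m' w" for n
    using assms(1) by (simp add: power_mult_distrib)
  then show ?case
    using hermite_poly_sums_base[OF assms(2)] by simp
next
  case (Suc m)
  let ?v = "of_real \<nu> :: complex"
  let ?e = "exp (?v * t * w * cnj z)"
  define c where "c n = t ^ n / (fact n * ?v ^ n)" for n
  let ?T = "\<lambda>k n. c n * hermite_poly \<nu> m n z * hermite_poly \<nu> n k w"
  let ?s = "\<lambda>k. (- t) ^ k * hermite_poly \<nu> m k (z - t * w) * ?e"
  have IH: "?T k sums ?s k" for k
    using Suc.IH by (simp add: c_def)
  \<comment> \<open>The second part of the recurrence for \<open>hermite_poly \<nu> (Suc m) n z\<close>. Its coefficient \<open>n\<close> cancels
    against \<open>n!\<close>, and the recurrence at \<open>w\<close> evaluates its shift by one.\<close>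
  let ?Q = "\<lambda>n. c n * (of_nat n * ?v * hermite_poly \<nu> m (n - 1) z) * hermite_poly \<nu> n m' w"
  let ?q = "t * ?v * w * ?s m' - t * of_nat m' * ?v * ?s (m' - 1)"
  have "c (Suc n) * (of_nat (Suc n) * ?v) = t * c n" for n
    using assms(1) of_nat_neq_0[of n, where ?'a = complex]
    by (simp add: c_def field_simps del: of_nat_Suc)
  then have "?Q (Suc n) = t * c n * hermite_poly \<nu> m n z * hermite_poly \<nu> (Suc n) m' w" for n
    by (metis diff_Suc_1 mult.assoc)
  moreover have "t * c n * hermite_poly \<nu> m n z * hermite_poly \<nu> (Suc n) m' w
      = t * ?v * w * ?T m' n - t * of_nat m' * ?v * ?T (m' - 1) n" for n
    by (simp add: algebra_simps)
  ultimately have "?Q (Suc n) = t * ?v * w * ?T m' n - t * of_nat m' * ?v * ?T (m' - 1) n" for n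
    by (simp only:)
  moreover have "(\<lambda>n. t * ?v * w * ?T m' n - t * of_nat m' * ?v * ?T (m' - 1) n) sums ?q"
    by (intro sums_diff sums_mult IH)
  ultimately have "(\<lambda>n. ?Q (Suc n)) sums ?q"
    by simp
  then have "?Q sums (?q + ?Q 0)"
    by (rule sums_Suc)
  then have "(\<lambda>n. ?v * z * ?T m' n - ?Q n) sums (?v * z * ?s m' - ?q)"
    by (intro sums_diff sums_mult IH) simp
  moreover have "?v * z * ?s m' - ?q =
      (- t) ^ m' * hermite_poly \<nu> (Suc m) m' (z - t * w) * ?e"
    by (cases m') (simp_all add: algebra_simps)
  moreover have "?v * z * ?T m' n - ?Q n =
      c n * hermite_poly \<nu> (Suc m) n z * hermite_poly \<nu> n m' w" for n
    by (simp add: algebra_simps)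
  ultimately show ?case
    by (simp only: c_def)
qed

theorem theorem3p8:
  fixes \<nu> :: real and m m' :: nat and t z w :: complex
  assumes "\<nu> > 0" and "norm t = 1"
  shows "(\<lambda>n. t ^ n / (fact n * of_real \<nu> ^ n)
              * complex_hermite \<nu> m n z * complex_hermite \<nu> n m' w)
         sums ((- t) ^ m' * complex_hermite \<nu> m m' (z - t * w) * exp (of_real \<nu> * t * w * cnj z))"
  using hermite_poly_sums[of \<nu> t m z m' w] assms
  by (simp add: complex_hermite_eq_hermite_poly)

end
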